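(* Let $A$ be alternative (not necessarily associative) and let $D\subseteq\mathbb{R}_{0,t_0}\times\mathbb{R}^\tau$ be invariant under the reflection $(\alpha,\beta)\mapsto(\alpha,\overline{\beta}^h)$ for every $h\in\{1,\ldots,\tau\}$. If $f=\mathcal{I}(F)\in\mathcal{S}(\Omega_D,A)$, then for every $K\in\mathscr{P}(\tau)$ the $K$-component of $F$ is \[F_K(\alpha,\beta)=2^{-\tau}\sum_{H\in\mathscr{P}(\tau)}(-1)^{|K\cap H|}\ ]I,f(\alpha+\overline{\beta}^HI)[_K\] for all $(\alpha,\beta)\in D$ and all $I\in\mathbb{T}$. As a consequence, the $T$-stem function $F$ inducing $f$ is unique, and $\mathcal{I}$ is a real vector space isomorphism from the space of $T$-stem functions on $D$ onto $\mathcal{S}(\Omega_D,A)$. Moreover, \[f(\alpha+\beta J)=2^{-\tau}\sum_{K,H\in\mathscr{P}(\tau)}(-1)^{|K\cap H|}\Big[\,J\,,\ ]I,f(\alpha+\overline{\beta}^HI)[_K\,\Big]_K\] for all $(\alpha,\beta)\in D$ and all $I,J\in\mathbb{T}$.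
   Context: $\mathbb{N}$ includes $0$. $A$ is a finite-dimensional alternative (unital) real $*$-algebra: a finite-dimensional real vector space with an $\mathbb{R}$-bilinear multiplication such that $x(xy)=x^2y$, $(xy)y=xy^2$ for all $x,y$, and with an involutive real-linear antiautomorphism $x\mapsto x^c$; $\mathbb{R}$ is identified with $\mathbb{R}1$. Set $t(x)=x+x^c$, $n(x)=xx^c$, $\mathbb{S}_A=\{x\in A:t(x)=0,\ n(x)=1\}$, assumed nonempty. Let $Q_A=\bigcup_{J\in\mathbb{S}_A}(\mathbb{R}+J\mathbb{R})$. A hypercomplex subspace of $A$ is a real vector subspace $V$ with $\mathbb{R}\subsetneq V\subseteq Q_A$; a hypercomplex basis of $V$ is an ordered real basis $(v_0,\ldots,v_n)$ with $n\ge1$, $v_0=1$, $v_s\in\mathbb{S}_A$ and $v_sv_u=-v_uv_s$ for distinct $s,u\in\{1,\ldots,n\}$. Setting. $V$ is a hypercomplex subspace of $A$ with hypercomplex basis $\mathcal{B}=(v_0,\ldots,v_n)$, completed to a real basis $\mathcal{B}'$ of $A$; unit spheres below refer to the Euclidean norm making $\mathcal{B}'$ orthonormal. Fix $\tau\in\{0,\ldots,n\}$ and a list of steps $T=(t_0,\ldots,t_\tau)\in\mathbb{N}^{\tau+1}$ with $0\le t_0<t_1<\cdots<t_\tau=n$. For $0\le\ell\le m\le n$, $\mathbb{R}_{\ell,m}=\mathrm{Span}(v_\ell,\ldots,v_m)$ and $\mathbb{S}_{\ell,m}$ is its unit sphere. The $T$-torus is $\mathbb{T}=\mathbb{S}_{t_0+1,t_1}\times\cdots\times\mathbb{S}_{t_{\tau-1}+1,t_\tau}\subset(\mathbb{S}_A)^\tau$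 if $\tau\ge1$; if $\tau=0$, "$J\in\mathbb{T}$" is read as $J=\emptyset$. For $\beta\in\mathbb{R}^\tau$, $J\in\mathbb{T}$: $\beta J:=\beta_1J_1+\cdots+\beta_\tau J_\tau\in V$ (zero if $\tau=0$). $\overline{\beta}^h$ is $\beta$ with its $h$-th component changed in sign; $\mathscr{P}(\tau)$ is the power set of $\{1,\ldots,\tau\}$; for $H\in\mathscr{P}(\tau)$, $\overline{\beta}^H$ is $\beta$ with the components of index in $H$ changed in sign. $\Omega_D:=\{\alpha+\beta J:(\alpha,\beta)\in D,\ J\in\mathbb{T}\}$ (and $\Omega_D=\{\alpha\in V:(\alpha,0)\in D\}$ if $\tau=0$). For $J\in\mathbb{T}$, $a\in A$: $[J,a]_\emptyset:=a=:\ ]J,a[_\emptyset$; for $K=\{k_1<\cdots<k_p\}\ne\emptyset$, \[[J,a]_K:=J_{k_1}(J_{k_2}(\cdots(J_{k_{p-1}}(J_{k_p}a))\cdots)),\qquad ]J,a[_K:=J_{k_p}^{-1}(J_{k_{p-1}}^{-1}(\cdots(J_{k_2}^{-1}(J_{k_1}^{-1}a))\cdots)),\] where $J_k^{-1}=-J_k$. Let $(E_K)_{K\in\mathscr{P}(\tau)}$ be the canonical basis of $\mathbb{R}^{2^\tau}$. A $T$-stem function on $D$ is a map $F=\sum_KE_KF_K:D\to A\otimes\mathbb{R}^{2^\tau}$, with components $F_K:D\to A$, such that $F_K(\alpha,\overline{\beta}^h)=F_K(\alpha,\beta)$ if $h\notin K$ and $F_K(\alpha,\overline{\beta}^h)=-F_K(\alpha,\beta)$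 if $h\in K$, for all $K\in\mathscr{P}(\tau)$, $(\alpha,\beta)\in D$, $h\in\{1,\ldots,\tau\}$. It induces the (well-defined) function $\mathcal{I}(F):\Omega_D\to A$, $\mathcal{I}(F)(\alpha+\beta J)=\sum_{K\in\mathscr{P}(\tau)}[J,F_K(\alpha,\beta)]_K$. Functions of this form are called $T$-functions; $\mathcal{S}(\Omega_D,A)$ is the set of $T$-functions $\Omega_D\to A$. *)

theory Defs
  imports "HOL-Analysis.Analysis" "HOL-Library.Function_Algebras"
begin

section \<open>Finite-dimensional alternative real *-algebras\<close>

text \<open>
  The algebra is the whole type. Multiplication is not assumed associative, so none of the
  library's multiplicative classes beyond the bare symbols apply. The axiom \<open>0 \<noteq> 1\<close> is what
  allows \<open>\<real>\<close> to be identified with \<open>\<real>1\<close>.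
\<close>

class alternative_star_algebra = real_vector + times + zero_neq_one +
  fixes sconj :: "'a \<Rightarrow> 'a"
  assumes times_add_left: "(x + y) * z = x * z + y * z"
    and times_add_right: "x * (y + z) = x * y + x * z"
    and times_scaleR_left: "(r *\<^sub>R x) * y = r *\<^sub>R (x * y)"
    and times_scaleR_right: "x * (r *\<^sub>R y) = r *\<^sub>R (x * y)"
    and one_times: "1 * x = x"
    and times_one: "x * 1 = x"
    and left_alternative: "x * (x * y) = (x * x) * y"
    and right_alternative: "(x * y) * y = x * (y * y)"
    and sconj_add: "sconj (x + y) = sconj x + sconj y"
    and sconj_scaleR: "sconj (r *\<^sub>R x) = r *\<^sub>R sconj x"
    and sconj_sconj: "sconj (sconj x) = x"
    and sconj_times: "sconj (x * y) = sconj y * sconj x"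
    and finite_dimensional: "\<exists>B. finite B \<and> (\<forall>x. \<exists>c. x = (\<Sum>b\<in>B. c b *\<^sub>R b))"

definition alg_trace :: "'a::alternative_star_algebra \<Rightarrow> 'a"
  where "alg_trace x = x + sconj x"

definition alg_norm :: "'a::alternative_star_algebra \<Rightarrow> 'a"
  where "alg_norm x = x * sconj x"

definition imag_units :: "'a::alternative_star_algebra set"
  where "imag_units = {x. alg_trace x = 0 \<and> alg_norm x = 1}"

definition quadratic_cone :: "'a::alternative_star_algebra set"
  where "quadratic_cone = (\<Union>J\<in>imag_units. {a *\<^sub>R 1 + b *\<^sub>R J | a b. True})"

definition hypercomplex_subspace :: "'a::alternative_star_algebra set \<Rightarrow> bool"
  where "hypercomplex_subspace V \<longleftrightarrow>
    subspace V \<and> range (\<lambda>r::real. r *\<^sub>R 1) \<subset> V \<and> V \<subseteq> quadratic_cone"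

text \<open>The basis \<open>(v\<^sub>0, \<dots>, v\<^sub>n)\<close> is given by the values of \<open>v\<close> at \<open>0, \<dots>, n\<close>; other values
  of \<open>v\<close> are irrelevant.\<close>

definition hypercomplex_basis ::
    "'a::alternative_star_algebra set \<Rightarrow> nat \<Rightarrow> (nat \<Rightarrow> 'a) \<Rightarrow> bool"
  where "hypercomplex_basis V n v \<longleftrightarrow>
    n \<ge> 1 \<and>
    inj_on v {0..n} \<and> independent (v ` {0..n}) \<and> span (v ` {0..n}) = V \<and>
    v 0 = 1 \<and>
    (\<forall>s\<in>{1..n}. v s \<in> imag_units) \<and>
    (\<forall>s\<in>{1..n}. \<forall>u\<in>{1..n}. s \<noteq> u \<longrightarrow> v s * v u = - (v u * v s))"

text \<open>The norm making the basis \<open>B\<close> orthonormal.\<close>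

definition basis_norm :: "'a::real_vector set \<Rightarrow> 'a \<Rightarrow> real"
  where "basis_norm B x = sqrt (\<Sum>b\<in>B. (representation B x b)\<^sup>2)"

definition span_range :: "(nat \<Rightarrow> 'a::real_vector) \<Rightarrow> nat \<Rightarrow> nat \<Rightarrow> 'a set"
  where "span_range v l m = span (v ` {l..m})"

definition unit_sphere :: "'a::real_vector set \<Rightarrow> (nat \<Rightarrow> 'a) \<Rightarrow> nat \<Rightarrow> nat \<Rightarrow> 'a set"
  where "unit_sphere B v l m = {x \<in> span_range v l m. basis_norm B x = 1}"


section \<open>T-tori, T-stem functions and T-functions\<close>

text \<open>
  The list of steps \<open>T = (t\<^sub>0, \<dots>, t\<^sub>\<tau>)\<close> is given by the values of \<open>t\<close> at \<open>0, \<dots>, \<tau>\<close>.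
  Elements of \<open>\<real>\<^sup>\<tau>\<close> and of the torus are extensional functions on \<open>{1..\<tau>}\<close>, i.e. elements of
  \<^const>\<open>PiE\<close>; for \<open>\<tau> = 0\<close> both sets have exactly one element, the empty tuple.
\<close>

definition steps :: "nat \<Rightarrow> nat \<Rightarrow> (nat \<Rightarrow> nat) \<Rightarrow> bool"
  where "steps n \<tau> t \<longleftrightarrow> \<tau> \<le> n \<and> strict_mono_on {0..\<tau>} t \<and> t \<tau> = n"

definition real_tuples :: "nat \<Rightarrow> (nat \<Rightarrow> real) set"
  where "real_tuples \<tau> = {1..\<tau>} \<rightarrow>\<^sub>E UNIV"

definition torus ::
    "'a::real_vector set \<Rightarrow> (nat \<Rightarrow> 'a) \<Rightarrow> nat \<Rightarrow> (nat \<Rightarrow> nat) \<Rightarrow> (nat \<Rightarrow> 'a) set"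
  where "torus B v \<tau> t = (\<Pi>\<^sub>E h\<in>{1..\<tau>}. unit_sphere B v (t (h - 1) + 1) (t h))"

definition tuple_comb :: "nat \<Rightarrow> (nat \<Rightarrow> real) \<Rightarrow> (nat \<Rightarrow> 'a::real_vector) \<Rightarrow> 'a"
  where "tuple_comb \<tau> \<beta> J = (\<Sum>h=1..\<tau>. \<beta> h *\<^sub>R J h)"

definition flip :: "nat set \<Rightarrow> (nat \<Rightarrow> real) \<Rightarrow> nat \<Rightarrow> real"
  where "flip H \<beta> = (\<lambda>h. if h \<in> H then - \<beta> h else \<beta> h)"

definition Omega ::
    "'a::real_vector set \<Rightarrow> (nat \<Rightarrow> 'a) \<Rightarrow> nat \<Rightarrow> (nat \<Rightarrow> nat) \<Rightarrow> ('a \<times> (nat \<Rightarrow> real)) set \<Rightarrow> 'a set"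
  where "Omega B v \<tau> t D =
    {\<alpha> + tuple_comb \<tau> \<beta> J | \<alpha> \<beta> J. (\<alpha>, \<beta>) \<in> D \<and> J \<in> torus B v \<tau> t}"

text \<open>
  With \<open>K = {k\<^sub>1 < \<dots> < k\<^sub>p}\<close>, \<open>lprod J a K\<close> is \<open>[J, a]\<^sub>K = J\<^sub>k\<^sub>1 (J\<^sub>k\<^sub>2 (\<dots> (J\<^sub>k\<^sub>p a)))\<close>, and
  \<open>lprod_inv J a K\<close> is \<open>]J, a[\<^sub>K = J\<^sub>k\<^sub>p\<^sup>-\<^sup>1 (\<dots> (J\<^sub>k\<^sub>2\<^sup>-\<^sup>1 (J\<^sub>k\<^sub>1\<^sup>-\<^sup>1 a)))\<close>, where \<open>J\<^sub>k\<^sup>-\<^sup>1 = - J\<^sub>k\<close>.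
\<close>

definition lprod :: "(nat \<Rightarrow> 'a::alternative_star_algebra) \<Rightarrow> 'a \<Rightarrow> nat set \<Rightarrow> 'a"
  where "lprod J a K = foldr (\<lambda>k x. J k * x) (sorted_list_of_set K) a"

definition lprod_inv :: "(nat \<Rightarrow> 'a::alternative_star_algebra) \<Rightarrow> 'a \<Rightarrow> nat set \<Rightarrow> 'a"
  where "lprod_inv J a K = fold (\<lambda>k x. (- J k) * x) (sorted_list_of_set K) a"

text \<open>
  An element \<open>\<Sum>\<^sub>K E\<^sub>K a\<^sub>K\<close> of \<open>A \<otimes> \<real>\<^bsup>2^\<tau>\<^esup>\<close> is encoded by its family of components \<open>K \<mapsto> a\<^sub>K\<close>,
  \<open>K \<subseteq> {1..\<tau>}\<close>. Functions with a restricted domain, such as stem functions on \<open>D\<close>, functions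
  on \<open>\<Omega>\<^sub>D\<close> and these component families, are encoded as total functions vanishing outside that
  domain; each function on the domain has exactly one such encoding, and the pointwise vector
  space operations on total functions restrict to the usual ones.
\<close>

definition stem_functions ::
    "nat \<Rightarrow> ('a \<times> (nat \<Rightarrow> real)) set \<Rightarrow> ('a::real_vector \<times> (nat \<Rightarrow> real) \<Rightarrow> nat set \<Rightarrow> 'a) set"
  where "stem_functions \<tau> D =
    {F. (\<forall>p K. p \<notin> D \<or> K \<notin> Pow {1..\<tau>} \<longrightarrow> F p K = 0) \<and>
        (\<forall>K\<in>Pow {1..\<tau>}. \<forall>(\<alpha>, \<beta>)\<in>D. \<forall>h\<in>{1..\<tau>}.
           (h \<notin> K \<longrightarrow> F (\<alpha>, flip {h} \<beta>) K = F (\<alpha>, \<beta>) K) \<and>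
           (h \<in> K \<longrightarrow> F (\<alpha>, flip {h} \<beta>) K = - F (\<alpha>, \<beta>) K))}"

text \<open>The value at \<open>x \<in> \<Omega>\<^sub>D\<close> is the one common to all representations \<open>x = \<alpha> + \<beta>J\<close>.\<close>

definition induced ::
    "'a::alternative_star_algebra set \<Rightarrow> (nat \<Rightarrow> 'a) \<Rightarrow> nat \<Rightarrow> (nat \<Rightarrow> nat) \<Rightarrow>
     ('a \<times> (nat \<Rightarrow> real)) set \<Rightarrow> ('a \<times> (nat \<Rightarrow> real) \<Rightarrow> nat set \<Rightarrow> 'a) \<Rightarrow> 'a \<Rightarrow> 'a"
  where "induced B v \<tau> t D F x =
    (if x \<in> Omega B v \<tau> t D
     then THE y. \<exists>\<alpha> \<beta> J. (\<alpha>, \<beta>) \<in> D \<and> J \<in> torus B v \<tau> t \<and> x = \<alpha> + tuple_comb \<tau> \<beta> J \<and>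
                          y = (\<Sum>K\<in>Pow {1..\<tau>}. lprod J (F (\<alpha>, \<beta>) K) K)
     else 0)"

definition T_functions ::
    "'a::alternative_star_algebra set \<Rightarrow> (nat \<Rightarrow> 'a) \<Rightarrow> nat \<Rightarrow> (nat \<Rightarrow> nat) \<Rightarrow>
     ('a \<times> (nat \<Rightarrow> real)) set \<Rightarrow> ('a \<Rightarrow> 'a) set"
  where "T_functions B v \<tau> t D = induced B v \<tau> t D ` stem_functions \<tau> D"


section \<open>Function spaces as real vector spaces\<close>

instantiation "fun" :: (type, real_vector) real_vector
begin

definition scaleR_fun :: "real \<Rightarrow> ('a \<Rightarrow> 'b) \<Rightarrow> 'a \<Rightarrow> 'b"
  where "scaleR_fun c f = (\<lambda>x. c *\<^sub>R f x)"

instance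
  by standard (auto simp: scaleR_fun_def fun_eq_iff scaleR_add_right scaleR_add_left)

end

definition linear_iso_on ::
    "'a::real_vector set \<Rightarrow> 'b::real_vector set \<Rightarrow> ('a \<Rightarrow> 'b) \<Rightarrow> bool"
  where "linear_iso_on S T \<phi> \<longleftrightarrow>
    subspace S \<and> subspace T \<and> bij_betw \<phi> S T \<and>
    (\<forall>x\<in>S. \<forall>y\<in>S. \<phi> (x + y) = \<phi> x + \<phi> y) \<and>
    (\<forall>c. \<forall>x\<in>S. \<phi> (c *\<^sub>R x) = c *\<^sub>R \<phi> x)"

end

theory Submission
  imports Defs
begin

text \<open>
  A point \<open>x = \<alpha> + \<beta>J\<close> determines \<open>\<alpha>\<close> and each product \<open>\<beta>\<^sub>h J\<^sub>h\<close>, because these vectors lie in the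
  spans of disjoint blocks of the basis (\<open>decomposition_unique\<close>). As \<open>J\<^sub>h\<close> has norm one, another
  representation of \<open>x\<close> can only change the signs of \<open>\<beta>\<^sub>h\<close> and \<open>J\<^sub>h\<close> simultaneously, or replace
  \<open>J\<^sub>h\<close> arbitrarily where \<open>\<beta>\<^sub>h = 0\<close>. The sign rules of a stem function compensate the first change,
  and they force \<open>F\<^sub>K(\<alpha>, \<beta>) = 0\<close> for \<open>h \<in> K\<close> in the second case. So the values of \<open>\<I>(F)\<close> are
  well defined (\<open>induced_eq\<close>).

  For a fixed \<open>I\<close>, evaluating \<open>f = \<I>(F)\<close> at the reflected points gives
  \<open>f(\<alpha> + \<beta>\<^bsup>H\<^esup> I) = \<Sum>\<^sub>L (-1)\<^bsup>|L \<inter> H|\<^esup> [I, F\<^sub>L(\<alpha>, \<beta>)]\<^sub>L\<close>,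
  where \<open>\<beta>\<^bsup>H\<^esup>\<close> is \<open>\<beta>\<close> with the components in \<open>H\<close> changed in sign. The matrix
  \<open>(-1)\<^bsup>|L \<inter> H|\<^esup>\<close> is the character table of \<open>(\<int>/2)\<^sup>\<tau>\<close>; its rows are orthogonal
  (\<open>subset_characters_orthogonal\<close>), so a signed sum over \<open>H\<close> isolates \<open>[I, F\<^sub>K(\<alpha>, \<beta>)]\<^sub>K\<close>.
  Although \<open>A\<close> need not be associative, the factors \<open>I\<^sub>k\<close> can then be cancelled one at a time
  (\<open>lprod_inv_lprod\<close>): \<open>I\<^sub>k (I\<^sub>k a) = (I\<^sub>k I\<^sub>k) a = -a\<close> by left alternativity, where \<open>I\<^sub>k I\<^sub>k = -1\<close>
  because \<open>I\<^sub>k\<close> is a normalised combination of anticommuting imaginary units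
  (\<open>unit_sphere_square\<close>). The formula expresses \<open>F\<close> through \<open>f\<close>, whence uniqueness and injectivity
  of \<open>\<I>\<close>, and substituting it in the definition of \<open>\<I>\<close> gives the representation formula.
\<close>


section \<open>Bilinearity of the product\<close>

lemma linear_times_right: "linear (\<lambda>y::'a::alternative_star_algebra. x * y)"
  by (intro linearI) (simp_all add: times_add_right times_scaleR_right)

lemma linear_times_left: "linear (\<lambda>x::'a::alternative_star_algebra. x * y)"
  by (intro linearI) (simp_all add: times_add_left times_scaleR_left)

lemma times_minus_left: "(- x) * y = - (x * y)" for x y :: "'a::alternative_star_algebra"
  using linear_neg[OF linear_times_left] by blast

lemma times_minus_right: "x * (- y) = - (x * y)" for x y :: "'a::alternative_star_algebra"
  using linear_neg[OF linear_times_right] by blast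

lemma finite_if_independent:
  fixes B :: "'a::alternative_star_algebra set"
  assumes "independent B"
  shows "finite B"
proof -
  obtain C :: "'a set" where C: "finite C" "\<forall>x. \<exists>c. x = (\<Sum>b\<in>C. c b *\<^sub>R b)"
    using finite_dimensional by blast
  have "x \<in> span C" for x
  proof -
    obtain c where "x = (\<Sum>b\<in>C. c b *\<^sub>R b)" using C(2) by blast
    then show ?thesis by (simp add: span_sum span_scale span_base)
  qed
  then show ?thesis using independent_span_bound[OF C(1) assms] by blast
qed

lemma imag_unit_square:
  fixes x :: "'a::alternative_star_algebra"
  assumes "x \<in> imag_units"
  shows "x * x = - 1"
proof -
  have "sconj x = - x" "x * sconj x = 1"
    using assms by (auto simp: imag_units_def alg_trace_def alg_norm_def eq_neg_iff_add_eq_0 add.commute)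
  then show ?thesis by (metis times_minus_right minus_minus)
qed

text \<open>In the sum of the double sum for the square and its transpose, the off-diagonal terms cancel.\<close>

lemma square_sum_anticommuting:
  fixes v :: "'b \<Rightarrow> 'a::alternative_star_algebra"
  assumes "finite S"
    and sq: "\<And>s. s \<in> S \<Longrightarrow> v s * v s = - 1"
    and anti: "\<And>s u. s \<in> S \<Longrightarrow> u \<in> S \<Longrightarrow> s \<noteq> u \<Longrightarrow> v s * v u = - (v u * v s)"
  shows "(\<Sum>s\<in>S. c s *\<^sub>R v s) * (\<Sum>s\<in>S. c s *\<^sub>R v s) = - ((\<Sum>s\<in>S. (c s)\<^sup>2) *\<^sub>R 1)"
    (is "?x * ?x = _")
proof -
  have swapped: "?x * ?x = (\<Sum>s\<in>S. \<Sum>u\<in>S. (c s * c u) *\<^sub>R (v u * v s))"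
    by (simp add: linear_sum[OF linear_times_left] linear_sum[OF linear_times_right]
        times_scaleR_left times_scaleR_right scaleR_sum_right)
  also have "\<dots> = (\<Sum>s\<in>S. \<Sum>u\<in>S. (c s * c u) *\<^sub>R (v s * v u))"
    by (subst sum.swap) (simp add: mult.commute)
  finally have expand: "?x * ?x = (\<Sum>s\<in>S. \<Sum>u\<in>S. (c s * c u) *\<^sub>R (v s * v u))" .
  have "?x * ?x + ?x * ?x = (\<Sum>s\<in>S. \<Sum>u\<in>S. (c s * c u) *\<^sub>R (v s * v u + v u * v s))"
    by (subst (1) expand, subst swapped) (simp add: sum.distrib scaleR_add_right)
  also have "\<dots> = (\<Sum>s\<in>S. \<Sum>u\<in>S. if u = s then (- 2 * (c s)\<^sup>2) *\<^sub>R 1 else 0)"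
  proof (intro sum.cong refl)
    fix s u assume su: "s \<in> S" "u \<in> S"
    show "(c s * c u) *\<^sub>R (v s * v u + v u * v s) = (if u = s then (- 2 * (c s)\<^sup>2) *\<^sub>R 1 else 0)"
    proof (cases "u = s")
      case True
      have "(- 1) + (- 1) = (- 2) *\<^sub>R (1::'a)" by (simp add: scaleR_2)
      then show ?thesis using True sq[OF su(1)] by (simp add: power2_eq_square)
    next
      case False
      then show ?thesis using anti[OF su] by simp
    qed
  qed
  also have "\<dots> = 2 *\<^sub>R (- ((\<Sum>s\<in>S. (c s)\<^sup>2) *\<^sub>R 1))"
    using \<open>finite S\<close> by (simp add: sum.delta scaleR_sum_left[symmetric] sum_distrib_left[symmetric] sum_negf)
  finally have "2 *\<^sub>R (?x * ?x) = 2 *\<^sub>R (- ((\<Sum>s\<in>S. (c s)\<^sup>2) *\<^sub>R 1))"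
    by (simp only: scaleR_2)
  then show ?thesis by (rule scaleR_left_imp_eq[rotated]) simp
qed


section \<open>Nested products\<close>

lemma linear_foldr_times:
  "linear (\<lambda>a. foldr (\<lambda>k x. (J k :: 'a::alternative_star_algebra) * x) ks a)"
proof (induction ks)
  case Nil
  show ?case by (simp add: linear_iff)
next
  case (Cons k ks)
  then show ?case using linear_compose[OF Cons linear_times_right[of "J k"]] by (simp add: o_def)
qed

lemma linear_lprod: "linear (\<lambda>a. lprod J a K)"
  unfolding lprod_def by (rule linear_foldr_times)

lemma linear_lprod_inv: "linear (\<lambda>a. lprod_inv J a K)"
  using linear_foldr_times[of "\<lambda>k. - J k" "rev (sorted_list_of_set K)"]
  unfolding lprod_inv_def by (simp add: foldr_conv_fold)

text \<open>The product \<open>]J, _[\<^sub>K\<close> strips the factors of \<open>[J, a]\<^sub>K\<close> from the outside inwards, each time by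
  the left alternative law for \<open>J\<^sub>k\<close> and \<open>J\<^sub>k\<close>.\<close>

lemma lprod_inv_lprod:
  fixes J :: "nat \<Rightarrow> 'a::alternative_star_algebra"
  assumes "finite K" and sq: "\<And>k. k \<in> K \<Longrightarrow> J k * J k = - 1"
  shows "lprod_inv J (lprod J a K) K = a"
proof -
  have "fold (\<lambda>k x. (- J k) * x) ks (foldr (\<lambda>k x. J k * x) ks a) = a" if "set ks \<subseteq> K" for ks
    using that
  proof (induction ks)
    case (Cons k ks)
    have "(- J k) * (J k * y) = y" for y
      using Cons.prems sq[of k]
      by (simp add: times_minus_left left_alternative one_times)
    then show ?case using Cons by simp
  qed simp
  then show ?thesis unfolding lprod_def lprod_inv_def using \<open>finite K\<close> by simp
qed

lemma lprod_scaleR: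
  fixes J :: "nat \<Rightarrow> 'a::alternative_star_algebra"
  assumes "finite K" and scaled: "\<And>k. k \<in> K \<Longrightarrow> J' k = c k *\<^sub>R J k"
  shows "lprod J' a K = (\<Prod>k\<in>K. c k) *\<^sub>R lprod J a K"
proof -
  have "foldr (\<lambda>k x. J' k * x) ks a = (\<Prod>k\<in>set ks. c k) *\<^sub>R foldr (\<lambda>k x. J k * x) ks a"
    if "set ks \<subseteq> K" "distinct ks" for ks
    using that
  proof (induction ks)
    case (Cons k ks)
    then show ?case using scaled[of k]
      by (simp add: times_scaleR_left times_scaleR_right mult.commute)
  qed simp
  from this[of "sorted_list_of_set K"] show ?thesis
    unfolding lprod_def using \<open>finite K\<close> by simp
qed


section \<open>Characters on the power set\<close>

lemma prod_sign:
  assumes "finite K"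
  shows "(\<Prod>k\<in>K. if k \<in> H then - 1 else 1 :: real) = (- 1) ^ card (K \<inter> H)"
  using prod.inter_restrict[OF assms, of "\<lambda>_. - 1 :: real" H] by simp

text \<open>For fixed \<open>K\<close> and \<open>L\<close> the summand is multiplicative in \<open>H\<close>, so the sum over all subsets of
  \<open>S\<close> factors into a product over \<open>S\<close>, in which an element of the symmetric difference of
  \<open>K\<close> and \<open>L\<close> contributes \<open>1 - 1\<close> and any other element contributes \<open>1 + 1\<close>.\<close>

lemma subset_characters_orthogonal:
  assumes "finite S" "K \<subseteq> S" "L \<subseteq> S"
  shows "(\<Sum>H\<in>Pow S. (- 1) ^ card (K \<inter> H) * (- 1) ^ card (L \<inter> H) :: real)
    = (if K = L then 2 ^ card S else 0)"
proof -
  define g :: "'a \<Rightarrow> real"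
    where "g h = (if h \<in> K then - 1 else 1) * (if h \<in> L then - 1 else 1)" for h
  have "(- 1) ^ card (K \<inter> H) * (- 1) ^ card (L \<inter> H) = prod g H" if "H \<in> Pow S" for H
  proof -
    have "finite H" using that \<open>finite S\<close> finite_subset by blast
    then show ?thesis
      by (simp add: g_def prod.distrib prod_sign Int_commute)
  qed
  then have "(\<Sum>H\<in>Pow S. (- 1) ^ card (K \<inter> H) * (- 1) ^ card (L \<inter> H)) = (\<Sum>H\<in>Pow S. prod g H)"
    by (intro sum.cong) auto
  also have "\<dots> = (\<Prod>h\<in>S. g h + 1)"
    by (simp add: prod_add[OF \<open>finite S\<close>])
  also have "\<dots> = (if K = L then 2 ^ card S else 0)"
  proof (cases "K = L")
    case True
    then have "g h + 1 = 2" for h by (simp add: g_def)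
    then show ?thesis using True by simp
  next
    case False
    then obtain h where "h \<in> S" "h \<in> K \<longleftrightarrow> h \<notin> L" using assms by blast
    then have "\<exists>h\<in>S. g h + 1 = 0" by (intro bexI[of _ h]) (auto simp: g_def)
    then show ?thesis using False \<open>finite S\<close> by (simp add: prod_zero_iff)
  qed
  finally show ?thesis .
qed


section \<open>Coordinates along blocks of a hypercomplex basis\<close>

locale stepped_basis =
  fixes V :: "'a::alternative_star_algebra set" and B :: "'a set" and v :: "nat \<Rightarrow> 'a"
    and n \<tau> :: nat and t :: "nat \<Rightarrow> nat"
  assumes hypercomplex: "hypercomplex_basis V n v"
    and v_in_basis: "v ` {0..n} \<subseteq> B"
    and independent: "independent B"
    and spanning: "span B = UNIV"
    and steps: "steps n \<tau> t"
begin

definition block :: "nat \<Rightarrow> nat set"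
  where "block h = {t (h - 1) + 1..t h}"

text \<open>Projections along the basis separate the summands \<open>\<alpha>\<close>, \<open>\<beta>\<^sub>1 J\<^sub>1\<close>, \<open>\<dots>\<close>, \<open>\<beta>\<^sub>\<tau> J\<^sub>\<tau>\<close> of a point.\<close>

definition coord_proj :: "nat set \<Rightarrow> 'a \<Rightarrow> 'a"
  where "coord_proj S x = (\<Sum>s\<in>S. representation B x (v s) *\<^sub>R v s)"

lemma finite_B: "finite B"
  using independent by (rule finite_if_independent)

lemma inj_v: "inj_on v {0..n}"
  using hypercomplex by (simp add: hypercomplex_basis_def)

lemma linear_coord_proj: "linear (coord_proj S)"
  by (intro linearI)
    (simp_all add: coord_proj_def representation_add[OF independent]
      representation_scale[OF independent] spanning scaleR_add_left sum.distrib scaleR_sum_right)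

lemma coord_proj_basis:
  assumes "S \<subseteq> {0..n}" "u \<in> {0..n}"
  shows "coord_proj S (v u) = (if u \<in> S then v u else 0)"
proof -
  have "finite S" using assms finite_subset by blast
  have "representation B (v u) (v s) *\<^sub>R v s = (if s = u then v u else 0)" if "s \<in> S" for s
  proof -
    have "v u \<in> B" using assms(2) v_in_basis by blast
    moreover have "v s = v u \<longleftrightarrow> s = u"
      using inj_on_eq_iff[OF inj_v] assms that by blast
    ultimately show ?thesis by (simp add: representation_basis[OF independent])
  qed
  then show ?thesis
    using \<open>finite S\<close> by (simp add: coord_proj_def)
qed

lemma coord_proj_same:
  assumes "S \<subseteq> {0..n}" "x \<in> span (v ` S)"
  shows "coord_proj S x = x"
proof (rule linear_eq_on[OF linear_coord_proj linear_id[unfolded id_def] assms(2)])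
  fix b assume "b \<in> v ` S"
  then show "coord_proj S b = b" using assms(1) by (auto simp: coord_proj_basis subset_iff)
qed

lemma coord_proj_disjoint:
  assumes "S \<subseteq> {0..n}" "S' \<subseteq> {0..n}" "S \<inter> S' = {}" "x \<in> span (v ` S')"
  shows "coord_proj S x = 0"
proof (rule linear_eq_on[OF linear_coord_proj linear_zero assms(4)])
  fix b assume "b \<in> v ` S'"
  then obtain u where "u \<in> S'" "b = v u" by blast
  moreover from this have "u \<in> {0..n}" "u \<notin> S" using assms(2,3) by blast+
  ultimately show "coord_proj S b = 0" using coord_proj_basis[OF assms(1)] by simp
qed

lemma basis_norm_eq:
  assumes "S \<subseteq> {0..n}" "x \<in> span (v ` S)"
  shows "(basis_norm B x)\<^sup>2 = (\<Sum>s\<in>S. (representation B x (v s))\<^sup>2)"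
proof -
  have sub: "v ` S \<subseteq> B" using assms(1) v_in_basis by blast
  have "representation B x b = 0" if "b \<notin> v ` S" for b
    using representation_extend[OF independent assms(2) sub] representation_ne_zero that by metis
  then have "(\<Sum>b\<in>v ` S. (representation B x b)\<^sup>2) = (\<Sum>b\<in>B. (representation B x b)\<^sup>2)"
    by (intro sum.mono_neutral_left finite_B sub) auto
  moreover have "(\<Sum>b\<in>v ` S. (representation B x b)\<^sup>2) = (\<Sum>s\<in>S. (representation B x (v s))\<^sup>2)"
    using inj_on_subset[OF inj_v assms(1)] by (simp add: sum.reindex)
  ultimately show ?thesis by (simp add: basis_norm_def sum_nonneg)
qed

lemma basis_norm_scaleR: "basis_norm B (c *\<^sub>R x) = \<bar>c\<bar> * basis_norm B x"
proof -
  have "representation B (c *\<^sub>R x) = (\<lambda>b. c * representation B x b)"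
    by (simp add: representation_scale[OF independent] spanning)
  then show ?thesis
    by (simp add: basis_norm_def power_mult_distrib sum_distrib_left[symmetric] real_sqrt_mult)
qed

text \<open>The condition \<open>1 \<le> l\<close> keeps \<open>v\<^sub>0 = 1\<close>, which is not an imaginary unit, out of the span.\<close>

lemma unit_sphere_square:
  assumes "1 \<le> l" "m \<le> n" "x \<in> unit_sphere B v l m"
  shows "x * x = - 1"
proof -
  have sub: "{l..m} \<subseteq> {0..n}" and x: "x \<in> span (v ` {l..m})" and norm: "basis_norm B x = 1"
    using assms by (auto simp: unit_sphere_def span_range_def)
  have coords: "(\<Sum>s=l..m. representation B x (v s) *\<^sub>R v s) = x"
    using coord_proj_same[OF sub x] by (simp add: coord_proj_def)
  have squares: "(\<Sum>s=l..m. (representation B x (v s))\<^sup>2) = 1"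
    using basis_norm_eq[OF sub x] norm by simp
  have in_range: "s \<in> {1..n}" if "s \<in> {l..m}" for s
    using that assms(1,2) by auto
  have sq: "v s * v s = - 1" if "s \<in> {l..m}" for s
    using in_range[OF that] hypercomplex unfolding hypercomplex_basis_def
    by (blast intro: imag_unit_square)
  have anti: "v s * v u = - (v u * v s)" if "s \<in> {l..m}" "u \<in> {l..m}" "s \<noteq> u" for s u
    using in_range that hypercomplex unfolding hypercomplex_basis_def by blast
  show ?thesis
    using square_sum_anticommuting[where S = "{l..m}" and v = v
        and c = "\<lambda>s. representation B x (v s)", OF finite_atLeastAtMost sq anti]
    unfolding coords squares by simp
qed

lemma steps_strict: "i < j \<Longrightarrow> j \<le> \<tau> \<Longrightarrow> t i < t j"
  using steps unfolding steps_def by (auto dest: strict_mono_onD[of "{0..\<tau>}" t i j])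

lemma steps_mono: "i \<le> j \<Longrightarrow> j \<le> \<tau> \<Longrightarrow> t i \<le> t j"
  using steps_strict[of i j] by (cases "i = j") simp_all

lemma steps_le: "j \<le> \<tau> \<Longrightarrow> t j \<le> n"
  using steps_mono[of j \<tau>] steps by (simp add: steps_def)

lemma block_subset: "h \<in> {1..\<tau>} \<Longrightarrow> block h \<subseteq> {0..n}"
  using steps_le[of h] by (auto simp: block_def)

lemma block_disjoint:
  assumes "h \<in> {1..\<tau>}" "k \<in> {1..\<tau>}" "h \<noteq> k"
  shows "block h \<inter> block k = {}"
proof -
  have "block h \<inter> block k = {}" if "h \<in> {1..\<tau>}" "k \<in> {1..\<tau>}" "h < k" for h k
  proof -
    have "h \<le> k - 1" "k - 1 \<le> \<tau>" using that by auto
    then have "t h \<le> t (k - 1)" by (rule steps_mono)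
    then show ?thesis by (auto simp: block_def)
  qed
  then show ?thesis using assms by (metis Int_commute linorder_neqE_nat)
qed

lemma block_disjoint_base:
  assumes "h \<in> {1..\<tau>}"
  shows "block h \<inter> {0..t 0} = {}"
proof -
  have "h - 1 \<le> \<tau>" using assms by auto
  then have "t 0 \<le> t (h - 1)" by (rule steps_mono[OF le0])
  then show ?thesis by (auto simp: block_def)
qed

lemma torus_component:
  assumes "J \<in> torus B v \<tau> t" "h \<in> {1..\<tau>}"
  shows "J h \<in> span (v ` block h)" "basis_norm B (J h) = 1" "J h * J h = - 1"
proof -
  have J: "J h \<in> unit_sphere B v (t (h - 1) + 1) (t h)"
    using assms unfolding torus_def by (rule PiE_mem)
  then show "J h \<in> span (v ` block h)" "basis_norm B (J h) = 1"
    by (auto simp: unit_sphere_def span_range_def block_def)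
  show "J h * J h = - 1"
    by (rule unit_sphere_square[OF _ _ J]) (use steps_le assms(2) in auto)
qed

text \<open>The steps increase strictly, so every block contains a basis vector, which has norm one.\<close>

lemma torus_nonempty: "torus B v \<tau> t \<noteq> {}"
proof -
  have "v (t h) \<in> unit_sphere B v (t (h - 1) + 1) (t h)" if h: "h \<in> {1..\<tau>}" for h
  proof -
    have "t (h - 1) < t h"
      using h by (intro steps_strict) auto
    then have mem: "t h \<in> block h" by (simp add: block_def)
    have sub: "{t h} \<subseteq> {0..n}" using steps_le[of h] h by auto
    have "v (t h) \<in> B" using sub v_in_basis by auto
    then have "(basis_norm B (v (t h)))\<^sup>2 = 1"
      by (subst basis_norm_eq[OF sub]) (simp_all add: span_base representation_basis[OF independent])
    moreover have "basis_norm B (v (t h)) \<ge> 0" by (simp add: basis_norm_def sum_nonneg)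
    ultimately have "basis_norm B (v (t h)) = 1" by (simp add: power2_eq_1_iff)
    then show ?thesis
      using mem by (auto simp: unit_sphere_def span_range_def block_def intro!: span_base)
  qed
  then have "restrict (\<lambda>h. v (t h)) {1..\<tau>} \<in> torus B v \<tau> t"
    unfolding torus_def by (intro PiE_I) auto
  then show ?thesis by blast
qed

lemma coord_proj_point:
  assumes "\<alpha> \<in> span_range v 0 (t 0)" "J \<in> torus B v \<tau> t" "h \<in> {1..\<tau>}"
  shows "coord_proj (block h) (\<alpha> + tuple_comb \<tau> \<beta> J) = \<beta> h *\<^sub>R J h"
proof -
  let ?P = "coord_proj (block h)"
  have "t 0 \<le> n" using steps_le by simp
  then have "?P \<alpha> = 0"
    using coord_proj_disjoint[OF block_subset _ block_disjoint_base] assms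
    by (simp add: span_range_def)
  moreover have "?P (J k) = (if k = h then J h else 0)" if "k \<in> {1..\<tau>}" for k
    using coord_proj_same[OF block_subset torus_component(1)[OF assms(2)]]
      coord_proj_disjoint[OF block_subset block_subset block_disjoint torus_component(1)[OF assms(2)]]
      that assms(3) by auto
  then have "?P (tuple_comb \<tau> \<beta> J) = (\<Sum>k=1..\<tau>. if k = h then \<beta> h *\<^sub>R J h else 0)"
    unfolding tuple_comb_def linear_sum[OF linear_coord_proj] linear_scale[OF linear_coord_proj]
    by (intro sum.cong) auto
  ultimately show ?thesis
    using assms(3) by (simp add: linear_add[OF linear_coord_proj])
qed

lemma decomposition_unique:
  assumes "\<alpha> \<in> span_range v 0 (t 0)" "\<alpha>' \<in> span_range v 0 (t 0)"
    and "J \<in> torus B v \<tau> t" "J' \<in> torus B v \<tau> t"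
    and eq: "\<alpha> + tuple_comb \<tau> \<beta> J = \<alpha>' + tuple_comb \<tau> \<beta>' J'"
  shows "\<alpha> = \<alpha>'" and "\<And>h. h \<in> {1..\<tau>} \<Longrightarrow> \<beta> h *\<^sub>R J h = \<beta>' h *\<^sub>R J' h"
proof -
  show comp: "\<beta> h *\<^sub>R J h = \<beta>' h *\<^sub>R J' h" if "h \<in> {1..\<tau>}" for h
    using coord_proj_point[OF assms(1,3) that, of \<beta>] coord_proj_point[OF assms(2,4) that, of \<beta>'] eq
    by simp
  have "tuple_comb \<tau> \<beta> J = tuple_comb \<tau> \<beta>' J'"
    unfolding tuple_comb_def by (intro sum.cong comp) auto
  then show "\<alpha> = \<alpha>'" using eq by simp
qed

text \<open>This holds because the components of torus points have norm one.\<close>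

lemma coefficient_up_to_sign:
  assumes "J \<in> torus B v \<tau> t" "J' \<in> torus B v \<tau> t" "h \<in> {1..\<tau>}"
    and "b *\<^sub>R J h = b' *\<^sub>R J' h"
  shows "b' = b \<or> b' = - b"
proof -
  have "\<bar>b\<bar> = \<bar>b'\<bar>"
    using arg_cong[OF assms(4), of "basis_norm B"] torus_component(2) assms(1-3)
    by (simp add: basis_norm_scaleR)
  then show ?thesis by linarith
qed

end


section \<open>Stem functions and the functions they induce\<close>

lemma flip_insert:
  assumes "h \<notin> H"
  shows "flip (insert h H) \<beta> = flip {h} (flip H \<beta>)"
  using assms by (auto simp: flip_def fun_eq_iff)

lemma stem_function_sign:
  assumes "F \<in> stem_functions \<tau> D" "K \<in> Pow {1..\<tau>}" "(\<alpha>, \<beta>) \<in> D" "h \<in> {1..\<tau>}"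
  shows "F (\<alpha>, flip {h} \<beta>) K = (if h \<in> K then - F (\<alpha>, \<beta>) K else F (\<alpha>, \<beta>) K)"
proof -
  have "\<forall>(\<alpha>, \<beta>)\<in>D. \<forall>h\<in>{1..\<tau>}.
           (h \<notin> K \<longrightarrow> F (\<alpha>, flip {h} \<beta>) K = F (\<alpha>, \<beta>) K) \<and>
           (h \<in> K \<longrightarrow> F (\<alpha>, flip {h} \<beta>) K = - F (\<alpha>, \<beta>) K)"
    using assms(1,2) unfolding stem_functions_def by blast
  then show ?thesis using assms(3,4) by auto
qed

lemma stem_function_outside:
  "F \<in> stem_functions \<tau> D \<Longrightarrow> p \<notin> D \<or> K \<notin> Pow {1..\<tau>} \<Longrightarrow> F p K = 0"
  unfolding stem_functions_def by blast

lemma subspace_stem_functions: "subspace (stem_functions \<tau> D)"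
  by (rule subspaceI) (auto simp: stem_functions_def scaleR_fun_def split_beta)

text \<open>Where a component \<open>\<beta>\<^sub>h\<close> vanishes, \<open>\<beta>\<close> is its own reflection, so \<open>F\<^sub>K\<close> equals its negative.\<close>

lemma stem_function_zero:
  assumes "F \<in> stem_functions \<tau> D" "K \<in> Pow {1..\<tau>}" "(\<alpha>, \<beta>) \<in> D" "h \<in> K" "\<beta> h = 0"
  shows "F (\<alpha>, \<beta>) K = 0"
proof -
  have "flip {h} \<beta> = \<beta>" using assms(5) by (auto simp: flip_def)
  then have "F (\<alpha>, \<beta>) K = - F (\<alpha>, \<beta>) K"
    using stem_function_sign[OF assms(1-3), of h] assms(2,4) by auto
  then show ?thesis by (simp add: eq_neg_iff_add_eq_0 scaleR_2[symmetric])
qed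

locale stem_domain = stepped_basis V B v n \<tau> t
  for V :: "'a::alternative_star_algebra set" and B :: "'a set" and v :: "nat \<Rightarrow> 'a"
    and n \<tau> :: nat and t :: "nat \<Rightarrow> nat" +
  fixes D :: "('a \<times> (nat \<Rightarrow> real)) set"
  assumes domain: "D \<subseteq> span_range v 0 (t 0) \<times> real_tuples \<tau>"
    and flip_closed: "\<forall>(\<alpha>, \<beta>)\<in>D. \<forall>h\<in>{1..\<tau>}. (\<alpha>, flip {h} \<beta>) \<in> D"
begin

abbreviation ind where "ind \<equiv> induced B v \<tau> t D"

lemma flip_subset_closed:
  assumes "(\<alpha>, \<beta>) \<in> D" "H \<subseteq> {1..\<tau>}"
  shows "(\<alpha>, flip H \<beta>) \<in> D"
proof -
  have "finite H" using assms(2) finite_subset by blast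
  then show ?thesis using assms(2)
  proof (induction H)
    case empty
    then show ?case using assms(1) by (simp add: flip_def)
  next
    case (insert h H)
    then have "(\<alpha>, flip H \<beta>) \<in> D" "h \<in> {1..\<tau>}" by auto
    then have "(\<alpha>, flip {h} (flip H \<beta>)) \<in> D" using flip_closed by blast
    then show ?case unfolding flip_insert[OF insert.hyps(2)] .
  qed
qed

lemma stem_function_flip:
  assumes F: "F \<in> stem_functions \<tau> D" and K: "K \<in> Pow {1..\<tau>}"
    and D: "(\<alpha>, \<beta>) \<in> D" and H: "H \<subseteq> {1..\<tau>}"
  shows "F (\<alpha>, flip H \<beta>) K = (- 1) ^ card (K \<inter> H) *\<^sub>R F (\<alpha>, \<beta>) K"
proof -
  have "finite H" using H finite_subset by blast
  then show ?thesis using H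
  proof (induction H)
    case empty
    then show ?case by (simp add: flip_def)
  next
    case (insert h H)
    have "F (\<alpha>, flip (insert h H) \<beta>) K =
        (if h \<in> K then - F (\<alpha>, flip H \<beta>) K else F (\<alpha>, flip H \<beta>) K)"
      unfolding flip_insert[OF insert.hyps(2)]
      using stem_function_sign[OF F K flip_subset_closed[OF D]] insert.prems by simp
    then show ?case
      using insert by (simp add: Int_insert_right)
  qed
qed

text \<open>Two representations of a point differ by a reflection of \<open>\<beta>\<close> in a set \<open>H\<close>, which multiplies
  \<open>F\<^sub>K(\<alpha>, \<beta>)\<close> by \<open>(-1)\<^bsup>|K \<inter> H|\<^esup>\<close>. If all \<open>\<beta>\<^sub>h\<close> with \<open>h \<in> K\<close> are nonzero, the units \<open>J\<^sub>h\<close> with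
  \<open>h \<in> K \<inter> H\<close> change sign as well, so the nested product acquires the same factor a second time.
  Otherwise both values of \<open>F\<^sub>K\<close> vanish.\<close>

lemma summand_well_defined:
  assumes F: "F \<in> stem_functions \<tau> D" and K: "K \<in> Pow {1..\<tau>}"
    and D: "(\<alpha>, \<beta>) \<in> D" "(\<alpha>', \<beta>') \<in> D"
    and J: "J \<in> torus B v \<tau> t" "J' \<in> torus B v \<tau> t"
    and eq: "\<alpha> + tuple_comb \<tau> \<beta> J = \<alpha>' + tuple_comb \<tau> \<beta>' J'"
  shows "lprod J' (F (\<alpha>', \<beta>') K) K = lprod J (F (\<alpha>, \<beta>) K) K"
proof -
  have base: "\<alpha> \<in> span_range v 0 (t 0)" "\<alpha>' \<in> span_range v 0 (t 0)"
    and tuples: "\<beta> \<in> real_tuples \<tau>" "\<beta>' \<in> real_tuples \<tau>"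
    using subsetD[OF domain D(1)] subsetD[OF domain D(2)] by simp_all
  note unique = decomposition_unique[OF base J eq]
  define H where "H = {h \<in> {1..\<tau>}. \<beta>' h \<noteq> \<beta> h}"
  have H: "H \<subseteq> {1..\<tau>}" by (auto simp: H_def)
  have sign: "\<beta>' h = \<beta> h \<or> \<beta>' h = - \<beta> h" if "h \<in> {1..\<tau>}" for h
    using coefficient_up_to_sign[OF J that unique(2)[OF that]] .
  have flip: "\<beta>' = flip H \<beta>"
  proof
    fix h
    show "\<beta>' h = flip H \<beta> h"
    proof (cases "h \<in> {1..\<tau>}")
      case True
      then show ?thesis using sign[OF True] by (auto simp: flip_def H_def)
    next
      case False
      \<comment> \<open>Tuples are extensional, so outside the index range both have the default value.\<close>
      then have "\<beta>' h = \<beta> h" using tuples PiE_arb unfolding real_tuples_def by metis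
      then show ?thesis using False H by (auto simp: flip_def)
    qed
  qed
  have scaled: "F (\<alpha>', \<beta>') K = (- 1) ^ card (K \<inter> H) *\<^sub>R F (\<alpha>, \<beta>) K"
    using stem_function_flip[OF F K D(1) H] flip unique(1) by simp
  have fin: "finite K" using K finite_subset by blast
  show ?thesis
  proof (cases "\<exists>h\<in>K. \<beta> h = 0")
    case True
    then have "F (\<alpha>, \<beta>) K = 0" using stem_function_zero[OF F K D(1)] by blast
    then show ?thesis using scaled by (simp add: linear_0[OF linear_lprod])
  next
    case False
    have "J' h = (if h \<in> H then - 1 else 1) *\<^sub>R J h" if "h \<in> K" for h
    proof -
      have h: "h \<in> {1..\<tau>}" and "\<beta> h \<noteq> 0" using that K False by auto
      have "\<beta> h *\<^sub>R J h = \<beta> h *\<^sub>R ((if h \<in> H then - 1 else 1) *\<^sub>R J' h)"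
        using unique(2)[OF h] flip by (simp add: flip_def)
      then have "J h = (if h \<in> H then - 1 else 1) *\<^sub>R J' h"
        using \<open>\<beta> h \<noteq> 0\<close> by (simp only: scaleR_cancel_left) simp
      then show ?thesis by simp
    qed
    from lprod_scaleR[OF fin this]
    have "lprod J' a K = (- 1) ^ card (K \<inter> H) *\<^sub>R lprod J a K" for a
      by (simp add: prod_sign[OF fin])
    then show ?thesis
      by (simp add: scaled linear_scale[OF linear_lprod] power_add[symmetric] mult_2[symmetric])
  qed
qed

lemma induced_eq:
  assumes F: "F \<in> stem_functions \<tau> D" and D: "(\<alpha>, \<beta>) \<in> D" and J: "J \<in> torus B v \<tau> t"
  shows "ind F (\<alpha> + tuple_comb \<tau> \<beta> J) = (\<Sum>K\<in>Pow {1..\<tau>}. lprod J (F (\<alpha>, \<beta>) K) K)"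
proof -
  let ?x = "\<alpha> + tuple_comb \<tau> \<beta> J"
  have "?x \<in> Omega B v \<tau> t D" using D J by (auto simp: Omega_def)
  moreover have "(THE y. \<exists>\<alpha>' \<beta>' J'. (\<alpha>', \<beta>') \<in> D \<and> J' \<in> torus B v \<tau> t \<and>
      ?x = \<alpha>' + tuple_comb \<tau> \<beta>' J' \<and> y = (\<Sum>K\<in>Pow {1..\<tau>}. lprod J' (F (\<alpha>', \<beta>') K) K))
    = (\<Sum>K\<in>Pow {1..\<tau>}. lprod J (F (\<alpha>, \<beta>) K) K)" (is "The ?P = ?y")
  proof (rule the_equality)
    show "?P ?y" using D J by blast
  next
    fix y assume "?P y"
    then obtain \<alpha>' \<beta>' J' where *: "(\<alpha>', \<beta>') \<in> D" "J' \<in> torus B v \<tau> t"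
      "?x = \<alpha>' + tuple_comb \<tau> \<beta>' J'" "y = (\<Sum>K\<in>Pow {1..\<tau>}. lprod J' (F (\<alpha>', \<beta>') K) K)"
      by blast
    then show "y = ?y"
      using summand_well_defined[OF F _ D *(1) J *(2,3)] by simp
  qed
  ultimately show ?thesis by (simp add: induced_def)
qed

lemma induced_outside: "x \<notin> Omega B v \<tau> t D \<Longrightarrow> ind F x = 0"
  by (simp add: induced_def)

lemma Omega_cases:
  assumes "x \<in> Omega B v \<tau> t D"
  obtains \<alpha> \<beta> J where "(\<alpha>, \<beta>) \<in> D" "J \<in> torus B v \<tau> t" "x = \<alpha> + tuple_comb \<tau> \<beta> J"
  using assms unfolding Omega_def by blast

lemma induced_add:
  assumes "F \<in> stem_functions \<tau> D" "G \<in> stem_functions \<tau> D"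
  shows "ind (F + G) = ind F + ind G"
proof
  fix x
  show "ind (F + G) x = (ind F + ind G) x"
  proof (cases "x \<in> Omega B v \<tau> t D")
    case True
    then show ?thesis
      using assms subspace_add[OF subspace_stem_functions assms]
      by (elim Omega_cases) (simp add: induced_eq linear_add[OF linear_lprod] sum.distrib)
  qed (simp add: induced_outside)
qed

lemma induced_scaleR:
  assumes "F \<in> stem_functions \<tau> D"
  shows "ind (c *\<^sub>R F) = c *\<^sub>R ind F"
proof
  fix x
  show "ind (c *\<^sub>R F) x = (c *\<^sub>R ind F) x"
  proof (cases "x \<in> Omega B v \<tau> t D")
    case True
    then show ?thesis
      using assms subspace_scale[OF subspace_stem_functions assms, of c]
      by (elim Omega_cases)
        (simp add: induced_eq scaleR_fun_def linear_scale[OF linear_lprod] scaleR_sum_right)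
  qed (simp add: induced_outside scaleR_fun_def)
qed

lemma induced_flip:
  assumes "F \<in> stem_functions \<tau> D" "(\<alpha>, \<beta>) \<in> D" "I \<in> torus B v \<tau> t" "H \<subseteq> {1..\<tau>}"
  shows "ind F (\<alpha> + tuple_comb \<tau> (flip H \<beta>) I)
    = (\<Sum>L\<in>Pow {1..\<tau>}. (- 1) ^ card (L \<inter> H) *\<^sub>R lprod I (F (\<alpha>, \<beta>) L) L)"
  unfolding induced_eq[OF assms(1) flip_subset_closed[OF assms(2,4)] assms(3)]
  by (intro sum.cong refl)
    (simp add: stem_function_flip[OF assms(1) _ assms(2,4)] linear_scale[OF linear_lprod])

text \<open>Inverting the character table first isolates \<open>[I, F\<^sub>K(\<alpha>, \<beta>)]\<^sub>K\<close>; since \<open>]I, _[\<^sub>K\<close> is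
  linear, it may be applied after the summation over \<open>H\<close>.\<close>

lemma stem_component_formula:
  assumes F: "F \<in> stem_functions \<tau> D" and K: "K \<in> Pow {1..\<tau>}"
    and D: "(\<alpha>, \<beta>) \<in> D" and I: "I \<in> torus B v \<tau> t"
  shows "F (\<alpha>, \<beta>) K = (1 / 2 ^ \<tau>) *\<^sub>R (\<Sum>H\<in>Pow {1..\<tau>}. (- 1) ^ card (K \<inter> H) *\<^sub>R
    lprod_inv I (ind F (\<alpha> + tuple_comb \<tau> (flip H \<beta>) I)) K)"
proof -
  let ?P = "Pow {1..\<tau>}" and ?a = "\<lambda>L. lprod I (F (\<alpha>, \<beta>) L) L"
  let ?f = "\<lambda>H. ind F (\<alpha> + tuple_comb \<tau> (flip H \<beta>) I)"
  have "(\<Sum>H\<in>?P. (- 1) ^ card (K \<inter> H) *\<^sub>R ?f H) =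
      (\<Sum>H\<in>?P. \<Sum>L\<in>?P. ((- 1) ^ card (K \<inter> H) * (- 1) ^ card (L \<inter> H)) *\<^sub>R ?a L)"
    by (intro sum.cong refl) (simp add: induced_flip[OF F D I] scaleR_sum_right)
  also have "\<dots> = (\<Sum>L\<in>?P. (\<Sum>H\<in>?P. (- 1) ^ card (K \<inter> H) * (- 1) ^ card (L \<inter> H)) *\<^sub>R ?a L)"
    by (subst sum.swap) (simp add: scaleR_sum_left)
  also have "\<dots> = (\<Sum>L\<in>?P. if L = K then 2 ^ \<tau> *\<^sub>R ?a K else 0)"
    using K by (intro sum.cong refl) (simp add: subset_characters_orthogonal)
  also have "\<dots> = 2 ^ \<tau> *\<^sub>R ?a K"
    using K by simp
  finally have isolated: "(\<Sum>H\<in>?P. (- 1) ^ card (K \<inter> H) *\<^sub>R ?f H) = 2 ^ \<tau> *\<^sub>R ?a K" .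
  have "(\<Sum>H\<in>?P. (- 1) ^ card (K \<inter> H) *\<^sub>R lprod_inv I (?f H) K)
      = lprod_inv I (\<Sum>H\<in>?P. (- 1) ^ card (K \<inter> H) *\<^sub>R ?f H) K"
    by (simp add: linear_sum[OF linear_lprod_inv] linear_scale[OF linear_lprod_inv])
  also have "\<dots> = 2 ^ \<tau> *\<^sub>R lprod_inv I (?a K) K"
    by (simp only: isolated linear_scale[OF linear_lprod_inv])
  also have "lprod_inv I (?a K) K = F (\<alpha>, \<beta>) K"
    using K torus_component(3)[OF I] finite_subset[of K "{1..\<tau>}"]
    by (intro lprod_inv_lprod) auto
  finally show ?thesis by simp
qed

lemma induced_injective: "inj_on ind (stem_functions \<tau> D)"
proof (rule inj_onI)
  fix F G assume FG: "F \<in> stem_functions \<tau> D" "G \<in> stem_functions \<tau> D" and eq: "ind F = ind G"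
  obtain I where I: "I \<in> torus B v \<tau> t" using torus_nonempty by blast
  have "F p K = G p K" for p K
  proof (cases "p \<in> D \<and> K \<in> Pow {1..\<tau>}")
    case True
    then show ?thesis
      using stem_component_formula[OF FG(1) _ _ I] stem_component_formula[OF FG(2) _ _ I] eq
      by (cases p) simp
  next
    case False
    then show ?thesis using stem_function_outside FG by metis
  qed
  then show "F = G" by (simp add: fun_eq_iff)
qed

lemma induced_linear_iso:
  "linear_iso_on (stem_functions \<tau> D) (T_functions B v \<tau> t D) ind"
proof -
  let ?S = "stem_functions \<tau> D"
  note sub = subspace_stem_functions[of \<tau> D]
  have "subspace (ind ` ?S)"
  proof (rule subspaceI)
    have "ind 0 = 0"
      using induced_scaleR[OF subspace_0[OF sub], of 0] by simp
    then show "0 \<in> ind ` ?S" using subspace_0[OF sub] by (metis imageI)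
  next
    fix f g assume "f \<in> ind ` ?S" "g \<in> ind ` ?S"
    then show "f + g \<in> ind ` ?S"
      using induced_add subspace_add[OF sub] by (smt (verit) image_iff)
  next
    fix c f assume "f \<in> ind ` ?S"
    then show "c *\<^sub>R f \<in> ind ` ?S"
      using induced_scaleR subspace_scale[OF sub] by (smt (verit) image_iff)
  qed
  then show ?thesis
    unfolding linear_iso_on_def T_functions_def
    using sub induced_injective induced_add induced_scaleR by (auto simp: bij_betw_def)
qed

lemma representation_formula:
  assumes F: "F \<in> stem_functions \<tau> D" and D: "(\<alpha>, \<beta>) \<in> D"
    and I: "I \<in> torus B v \<tau> t" and J: "J \<in> torus B v \<tau> t"
  shows "ind F (\<alpha> + tuple_comb \<tau> \<beta> J) =
    (1 / 2 ^ \<tau>) *\<^sub>R (\<Sum>K\<in>Pow {1..\<tau>}. \<Sum>H\<in>Pow {1..\<tau>}. (- 1) ^ card (K \<inter> H) *\<^sub>R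
      lprod J (lprod_inv I (ind F (\<alpha> + tuple_comb \<tau> (flip H \<beta>) I)) K) K)"
  unfolding induced_eq[OF F D J] scaleR_sum_right[of "1 / 2 ^ \<tau>" _ "Pow {1..\<tau>}"]
proof (rule sum.cong[OF refl])
  fix K assume K: "K \<in> Pow {1..\<tau>}"
  show "lprod J (F (\<alpha>, \<beta>) K) K = (\<Sum>H\<in>Pow {1..\<tau>}. (1 / 2 ^ \<tau>) *\<^sub>R (- 1) ^ card (K \<inter> H) *\<^sub>R
      lprod J (lprod_inv I (ind F (\<alpha> + tuple_comb \<tau> (flip H \<beta>) I)) K) K)"
    by (subst stem_component_formula[OF F K D I])
      (simp only: linear_scale[OF linear_lprod] linear_sum[OF linear_lprod] scaleR_sum_right)
qed

end


section \<open>The component formula and its consequences\<close>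

theorem theorem8p6:
  fixes V :: "'a::alternative_star_algebra set"
    and B' :: "'a set"
    and v :: "nat \<Rightarrow> 'a"
    and n \<tau> :: nat
    and t :: "nat \<Rightarrow> nat"
    and D :: "('a \<times> (nat \<Rightarrow> real)) set"
  assumes "(imag_units :: 'a set) \<noteq> {}"
    and "hypercomplex_subspace V"
    and "hypercomplex_basis V n v"
    and "v ` {0..n} \<subseteq> B'" and "independent B'" and "span B' = UNIV"
    and "steps n \<tau> t"
    and "D \<subseteq> span_range v 0 (t 0) \<times> real_tuples \<tau>"
    and "\<forall>(\<alpha>, \<beta>)\<in>D. \<forall>h\<in>{1..\<tau>}. (\<alpha>, flip {h} \<beta>) \<in> D"
  shows
    "(\<forall>F\<in>stem_functions \<tau> D. \<forall>f. f = induced B' v \<tau> t D F \<longrightarrow>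
        (\<forall>K\<in>Pow {1..\<tau>}. \<forall>(\<alpha>, \<beta>)\<in>D. \<forall>I\<in>torus B' v \<tau> t.
           F (\<alpha>, \<beta>) K =
             (1 / 2 ^ \<tau>) *\<^sub>R (\<Sum>H\<in>Pow {1..\<tau>}. (-1) ^ card (K \<inter> H) *\<^sub>R
                lprod_inv I (f (\<alpha> + tuple_comb \<tau> (flip H \<beta>) I)) K)))
     \<and> (\<forall>f\<in>T_functions B' v \<tau> t D. \<exists>!F. F \<in> stem_functions \<tau> D \<and> f = induced B' v \<tau> t D F)
     \<and> linear_iso_on (stem_functions \<tau> D) (T_functions B' v \<tau> t D) (induced B' v \<tau> t D)
     \<and> (\<forall>f\<in>T_functions B' v \<tau> t D.
          \<forall>(\<alpha>, \<beta>)\<in>D. \<forall>I\<in>torus B' v \<tau> t. \<forall>J\<in>torus B' v \<tau> t.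
           f (\<alpha> + tuple_comb \<tau> \<beta> J) =
             (1 / 2 ^ \<tau>) *\<^sub>R (\<Sum>K\<in>Pow {1..\<tau>}. \<Sum>H\<in>Pow {1..\<tau>}. (-1) ^ card (K \<inter> H) *\<^sub>R
                lprod J (lprod_inv I (f (\<alpha> + tuple_comb \<tau> (flip H \<beta>) I)) K) K))"
proof -
  interpret stem_domain V B' v n \<tau> t D
    using assms(3-9) by unfold_locales
  have component: "\<forall>(\<alpha>, \<beta>)\<in>D. \<forall>I\<in>torus B' v \<tau> t. F (\<alpha>, \<beta>) K =
      (1 / 2 ^ \<tau>) *\<^sub>R (\<Sum>H\<in>Pow {1..\<tau>}. (-1) ^ card (K \<inter> H) *\<^sub>R
        lprod_inv I (f (\<alpha> + tuple_comb \<tau> (flip H \<beta>) I)) K)"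
    if "F \<in> stem_functions \<tau> D" "f = ind F" "K \<in> Pow {1..\<tau>}" for F f K
    unfolding \<open>f = ind F\<close> using stem_component_formula[OF that(1,3)] by blast
  have unique: "\<exists>!F. F \<in> stem_functions \<tau> D \<and> f = ind F" if "f \<in> T_functions B' v \<tau> t D" for f
    using that induced_injective unfolding T_functions_def by (auto dest: inj_onD)
  have representation: "\<forall>(\<alpha>, \<beta>)\<in>D. \<forall>I\<in>torus B' v \<tau> t. \<forall>J\<in>torus B' v \<tau> t.
      f (\<alpha> + tuple_comb \<tau> \<beta> J) =
        (1 / 2 ^ \<tau>) *\<^sub>R (\<Sum>K\<in>Pow {1..\<tau>}. \<Sum>H\<in>Pow {1..\<tau>}. (-1) ^ card (K \<inter> H) *\<^sub>R
          lprod J (lprod_inv I (f (\<alpha> + tuple_comb \<tau> (flip H \<beta>) I)) K) K)"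
    if "f \<in> T_functions B' v \<tau> t D" for f
  proof -
    obtain F where F: "F \<in> stem_functions \<tau> D" and f: "f = ind F"
      using \<open>f \<in> _\<close> unfolding T_functions_def by (elim imageE)
    show ?thesis unfolding f using representation_formula[OF F] by blast
  qed
  show ?thesis
    using component unique induced_linear_iso representation by (intro conjI ballI allI impI) simp_all
qed

end
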